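(* If $G$ is a triangle-free graph with no star-cutset, then $\varphi(G)\ge |E(G)|-1$.
   Context: Graphs are finite and simple. Two sets overlap if they intersect but neither contains the other. An overlap representation of a graph $G$ is an assignment $f$ of sets to the vertices of $G$ such that, for distinct vertices $u,v$, $uv\in E(G)$ if and only if $f(u)$ and $f(v)$ overlap. When the assigned sets are finite, the size of $f$ is $\left|\bigcup_{v\in V(G)} f(v)\right|$. The overlap number $\varphi(G)$ is the minimum size of an overlap representation of $G$ by finite sets. A star-cutset in $G$ is a separating set $S\subseteq V(G)$ (i.e., $G-S$ is disconnected) containing a vertex $x$ adjacent to all of $S-\{x\}$. *)

theory Defs
  imports Main
begin

text \<open>A finite simple graph is given by its vertex set and its set of edges, each edge being
  a set of two distinct vertices.\<close>

definition simple_graph :: "'a set \<Rightarrow> 'a set set \<Rightarrow> bool" where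
  "simple_graph V E \<longleftrightarrow>
     finite V \<and> (\<forall>e\<in>E. \<exists>u v. u \<in> V \<and> v \<in> V \<and> u \<noteq> v \<and> e = {u, v})"

definition triangle_free :: "'a set set \<Rightarrow> bool" where
  "triangle_free E \<longleftrightarrow>
     \<not> (\<exists>u v w. u \<noteq> v \<and> v \<noteq> w \<and> u \<noteq> w \<and> {u, v} \<in> E \<and> {v, w} \<in> E \<and> {u, w} \<in> E)"

definition del_vertices_edges :: "'a set set \<Rightarrow> 'a set \<Rightarrow> 'a set set" where
  "del_vertices_edges E S = {e \<in> E. e \<inter> S = {}}"

text \<open>Under this definition the graph without vertices is not disconnected, so deleting all
  vertices (or all but one) never separates.\<close>

definition disconnected :: "'a set \<Rightarrow> 'a set set \<Rightarrow> bool" where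
  "disconnected V E \<longleftrightarrow>
     (\<exists>u\<in>V. \<exists>v\<in>V. (u, v) \<notin> {(a, b). {a, b} \<in> E}\<^sup>*)"

definition separating_set :: "'a set \<Rightarrow> 'a set set \<Rightarrow> 'a set \<Rightarrow> bool" where
  "separating_set V E S \<longleftrightarrow> S \<subseteq> V \<and> disconnected (V - S) (del_vertices_edges E S)"

definition star_cutset :: "'a set \<Rightarrow> 'a set set \<Rightarrow> 'a set \<Rightarrow> bool" where
  "star_cutset V E S \<longleftrightarrow>
     separating_set V E S \<and> (\<exists>x\<in>S. \<forall>y\<in>S - {x}. {x, y} \<in> E)"

definition overlap :: "'b set \<Rightarrow> 'b set \<Rightarrow> bool" where
  "overlap A B \<longleftrightarrow> A \<inter> B \<noteq> {} \<and> \<not> A \<subseteq> B \<and> \<not> B \<subseteq> A"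

definition overlap_representation :: "'a set \<Rightarrow> 'a set set \<Rightarrow> ('a \<Rightarrow> 'b set) \<Rightarrow> bool" where
  "overlap_representation V E f \<longleftrightarrow>
     (\<forall>u\<in>V. \<forall>v\<in>V. u \<noteq> v \<longrightarrow> ({u, v} \<in> E \<longleftrightarrow> overlap (f u) (f v)))"

definition representation_size :: "'a set \<Rightarrow> ('a \<Rightarrow> 'b set) \<Rightarrow> nat" where
  "representation_size V f = card (\<Union>v\<in>V. f v)"

text \<open>The represented sets are taken to consist of natural numbers. This is no restriction, since
  for a finite graph the union of the finitely many finite sets can be relabelled injectively
  by natural numbers; see \<open>overlap_number_le\<close>. That the minimum is taken over a nonempty set
  is \<open>ex_overlap_representation\<close>.\<close>

definition overlap_number :: "'a set \<Rightarrow> 'a set set \<Rightarrow> nat" where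
  "overlap_number V E =
     (LEAST n. \<exists>f :: 'a \<Rightarrow> nat set.
        overlap_representation V E f \<and> (\<forall>v\<in>V. finite (f v)) \<and> representation_size V f = n)"

lemma relabel_overlap_representation:
  fixes f :: "'a \<Rightarrow> 'b set"
  assumes "finite V" "overlap_representation V E f" "\<And>v. v \<in> V \<Longrightarrow> finite (f v)"
  shows "\<exists>g :: 'a \<Rightarrow> nat set. overlap_representation V E g \<and> (\<forall>v\<in>V. finite (g v)) \<and>
           representation_size V g = representation_size V f"
proof -
  define U where "U = (\<Union>v\<in>V. f v)"
  have "finite U"
    using assms(1,3) by (auto simp: U_def)
  then obtain h :: "'b \<Rightarrow> nat" where h: "inj_on h U"
    using finite_imp_inj_to_nat_seg by metis
  have sub: "f v \<subseteq> U" if "v \<in> V" for v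
    using that by (auto simp: U_def)
  have "overlap (h ` f u) (h ` f v) \<longleftrightarrow> overlap (f u) (f v)" if "u \<in> V" "v \<in> V" for u v
  proof -
    have "h ` f u \<subseteq> h ` f v \<longleftrightarrow> f u \<subseteq> f v" if "u \<in> V" "v \<in> V" for u v
      using inj_on_image_mem_iff[OF h _ sub[OF that(2)]] sub[OF that(1)] by blast
    then show ?thesis
      using that inj_on_image_Int[OF h sub[OF that(1)] sub[OF that(2)]]
      unfolding overlap_def by (metis image_is_empty)
  qed
  then have "overlap_representation V E (\<lambda>v. h ` f v)"
    using assms(2) by (simp add: overlap_representation_def)
  moreover have "representation_size V (\<lambda>v. h ` f v) = representation_size V f"
    unfolding representation_size_def using card_image[OF h] by (simp add: U_def image_UN)
  ultimately show ?thesis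
    using assms(3) by blast
qed

lemma overlap_number_le:
  fixes f :: "'a \<Rightarrow> 'b set"
  assumes "finite V" "overlap_representation V E f" "\<And>v. v \<in> V \<Longrightarrow> finite (f v)"
  shows "overlap_number V E \<le> representation_size V f"
  unfolding overlap_number_def
  by (rule Least_le) (rule relabel_overlap_representation[OF assms])

lemma ex_overlap_representation:
  assumes "simple_graph V E"
  shows "\<exists>f :: 'a \<Rightarrow> nat set. overlap_representation V E f \<and> (\<forall>v\<in>V. finite (f v))"
proof -
  have fin: "finite V" and E: "\<And>e. e \<in> E \<Longrightarrow> \<exists>u v. u \<in> V \<and> v \<in> V \<and> u \<noteq> v \<and> e = {u, v}"
    using assms by (auto simp: simple_graph_def)
  have "E \<subseteq> Pow V"
    using E by fastforce
  then have finE: "finite E"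
    using fin by (simp add: finite_subset)
  define f where "f v = insert {v} {e \<in> E. v \<in> e}" for v
  have nsing: "{v} \<notin> E" for v
    using E by fastforce
  have "{u, v} \<in> E \<longleftrightarrow> overlap (f u) (f v)" if "u \<noteq> v" for u v
  proof -
    have nsub: "\<not> f u \<subseteq> f v" "\<not> f v \<subseteq> f u"
      using that by (auto simp: f_def)
    have edge: "e = {u, v}" if "e \<in> E" "u \<in> e" "v \<in> e" for e
      using E[OF that(1)] that \<open>u \<noteq> v\<close> by blast
    have "f u \<inter> f v \<noteq> {} \<longleftrightarrow> {u, v} \<in> E"
    proof
      assume "f u \<inter> f v \<noteq> {}"
      then obtain e where "e \<in> E" "u \<in> e" "v \<in> e"
        using \<open>u \<noteq> v\<close> nsing by (fastforce simp: f_def)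
      with edge show "{u, v} \<in> E" by blast
    qed (auto simp: f_def)
    with nsub show ?thesis by (simp add: overlap_def)
  qed
  then have "overlap_representation V E f"
    by (simp add: overlap_representation_def)
  moreover have "finite (f v)" for v
    using finE by (simp add: f_def)
  ultimately show ?thesis
    using relabel_overlap_representation[OF fin] by blast
qed

end

theory Submission
  imports Defs
begin

text \<open>Fix an overlap representation \<open>f\<close> by finite sets. If all pairs of non-adjacent vertices had
  disjoint sets, then \<open>f\<close> would be an intersection representation; as the graph has no triangles,
  every point would lie in at most two of the sets, so distinct edges would need distinct points and
  there would be at least \<open>|E|\<close> points. The obstruction is containment between the sets of
  non-adjacent vertices. Call a vertex \<^emph>\<open>engulfing\<close> if its set contains the set of another vertex that
  is not a neighbour of it.

  If \<open>f u \<subseteq> f v\<close> with \<open>u\<close> and \<open>v\<close> non-adjacent, then every neighbour of \<open>u\<close> outside the closed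
  neighbourhood \<open>N[v]\<close> also has its set inside \<open>f v\<close>. Containment in \<open>f v\<close> therefore spreads along
  the edges of \<open>G - N[v]\<close>, which is connected because \<open>N[v]\<close> is not a star-cutset: an
  engulfing vertex contains the sets of \<^emph>\<open>all\<close> its non-neighbours
  (\<open>engulfing_contains_all_nonneighbours\<close>).

  If two engulfing vertices are not adjacent, their sets are equal and the graph is so
  small (at most four edges) that the three points needed for a single overlap suffice
  (\<open>card_edges_le_4_of_nonadjacent_engulfing\<close>). Otherwise the engulfing vertices form a clique, and
  so at most one edge joins two of them. Every other edge \<open>e\<close> has a private
  point, from which \<open>e\<close> can be recovered by looking at the non-engulfing vertices whose sets contain
  the point: for an edge between non-engulfing vertices these are precisely its two ends, and for an
  edge from \<open>a\<close> to an engulfing \<open>b\<close> a point of \<open>f a - f b\<close> lies in the set of no other non-engulfing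
  vertex than \<open>a\<close> (\<open>private_point\<close>). Hence there are at least \<open>|E| - 1\<close> points.\<close>

section \<open>Overlap representations of triangle-free graphs without star-cutset\<close>

locale starless_overlap_representation =
  fixes V :: "'a set" and E :: "'a set set" and f :: "'a \<Rightarrow> 'b set"
  assumes graph: "simple_graph V E"
    and triangle_free: "triangle_free E"
    and no_star_cutset: "\<not> (\<exists>S. star_cutset V E S)"
    and representation: "overlap_representation V E f"
    and finite_sets: "v \<in> V \<Longrightarrow> finite (f v)"
begin

definition engulfing :: "'a \<Rightarrow> bool" where
  "engulfing v \<longleftrightarrow> v \<in> V \<and> (\<exists>u\<in>V. u \<noteq> v \<and> {u, v} \<notin> E \<and> f u \<subseteq> f v)"

lemma edge_ends: "{u, v} \<in> E \<Longrightarrow> u \<in> V \<and> v \<in> V \<and> u \<noteq> v"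
  using graph unfolding simple_graph_def by (metis doubleton_eq_iff insert_absorb2)

lemma edgeE:
  assumes "e \<in> E"
  obtains u v where "e = {u, v}" "u \<in> V" "v \<in> V" "u \<noteq> v"
  using assms graph unfolding simple_graph_def by metis

lemma no_triangle: "{u, v} \<in> E \<Longrightarrow> {v, w} \<in> E \<Longrightarrow> {u, w} \<notin> E"
  using triangle_free edge_ends unfolding triangle_free_def by metis

lemma edge_iff_overlap: "u \<in> V \<Longrightarrow> v \<in> V \<Longrightarrow> u \<noteq> v \<Longrightarrow> {u, v} \<in> E \<longleftrightarrow> overlap (f u) (f v)"
  using representation unfolding overlap_representation_def by blast

lemma edge_overlap: "{u, v} \<in> E \<Longrightarrow> overlap (f u) (f v)"
  using edge_iff_overlap edge_ends by blast

lemma nonedge_cases: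
  assumes "u \<in> V" "v \<in> V" "u \<noteq> v" "{u, v} \<notin> E"
  obtains "f u \<inter> f v = {}" | "f u \<subseteq> f v" | "f v \<subseteq> f u"
  using edge_iff_overlap[OF assms(1-3)] assms(4) unfolding overlap_def by blast

lemma connected_minus_star:
  assumes "S \<subseteq> V" "x \<in> S" "\<And>y. y \<in> S \<Longrightarrow> y \<noteq> x \<Longrightarrow> {x, y} \<in> E" "a \<in> V - S" "b \<in> V - S"
  shows "(a, b) \<in> {(c, d). {c, d} \<in> del_vertices_edges E S}\<^sup>*"
proof (rule ccontr)
  assume "\<not> ?thesis"
  then have "separating_set V E S"
    using assms(1,4,5) unfolding separating_set_def disconnected_def by blast
  then have "star_cutset V E S"
    using assms(2,3) unfolding star_cutset_def by blast
  with no_star_cutset show False by blast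
qed

section \<open>Engulfing vertices\<close>

text \<open>Containment in \<open>f v\<close> spreads along the edges of the graph minus \<open>N[v]\<close>: if \<open>f y \<subseteq> f v\<close> and \<open>z\<close>
  is adjacent to \<open>y\<close> but not to \<open>v\<close>, then \<open>f z\<close> meets \<open>f v\<close> and cannot contain it, since it would then
  contain \<open>f y\<close>.\<close>

lemma engulfing_contains_all_nonneighbours:
  assumes "engulfing v" "w \<in> V" "w \<noteq> v" "{w, v} \<notin> E"
  shows "f w \<subseteq> f v"
proof -
  obtain u where u: "u \<in> V" "u \<noteq> v" "{u, v} \<notin> E" "f u \<subseteq> f v" and v: "v \<in> V"
    using assms(1) unfolding engulfing_def by blast
  define S where "S = insert v {y \<in> V. {v, y} \<in> E}"
  have "(u, w) \<in> {(c, d). {c, d} \<in> del_vertices_edges E S}\<^sup>*"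
    by (rule connected_minus_star[where x = v])
      (use u v assms in \<open>auto simp: S_def insert_commute\<close>)
  then show ?thesis
  proof (induction rule: rtrancl_induct)
    case base
    show ?case by (rule u(4))
  next
    case (step y z)
    from step(2) have yz: "{y, z} \<in> E" "z \<notin> S"
      by (auto simp: del_vertices_edges_def)
    with edge_ends have z: "z \<in> V" "z \<noteq> v" "{z, v} \<notin> E"
      by (auto simp: S_def insert_commute)
    have "overlap (f y) (f z)"
      by (rule edge_overlap[OF yz(1)])
    with step(3) nonedge_cases[OF z(1) v z(2,3)] show ?case
      unfolding overlap_def by blast
  qed
qed

lemma non_engulfing_disjoint:
  assumes "u \<in> V" "v \<in> V" "u \<noteq> v" "{u, v} \<notin> E" "\<not> engulfing u" "\<not> engulfing v"
  shows "f u \<inter> f v = {}"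
  using nonedge_cases[OF assms(1-4)] assms unfolding engulfing_def
  by (metis insert_commute)

text \<open>Two such vertices \<open>u\<close> and \<open>v\<close> contain each other's sets, so they are twins. Hence \<open>u\<close> is isolated
  outside \<open>N[v]\<close>, and by connectivity there is nothing else outside \<open>N[v]\<close>. The graph is thus
  \<open>K\<^bsub>2,m\<^esub>\<close>, where \<open>m \<ge> 3\<close> is impossible because \<open>u\<close>, \<open>v\<close> and one common neighbour would
  form a star-cutset.\<close>

lemma card_edges_le_4_of_nonadjacent_engulfing:
  assumes "engulfing u" "engulfing v" "u \<noteq> v" "{u, v} \<notin> E"
  shows "card E \<le> 4"
proof -
  have uv: "u \<in> V" "v \<in> V" using assms(1,2) unfolding engulfing_def by auto
  have eq: "f u = f v"
    using engulfing_contains_all_nonneighbours[OF assms(1) uv(2)]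
      engulfing_contains_all_nonneighbours[OF assms(2) uv(1)] assms(3,4)
    by (simp add: insert_commute subset_antisym)
  have twins: "{u, w} \<in> E \<longleftrightarrow> {v, w} \<in> E" for w
    using edge_overlap edge_iff_overlap[OF uv(1), of w] edge_iff_overlap[OF uv(2), of w]
      edge_ends eq assms(4) by (metis insert_commute)
  define N where "N = {y \<in> V. {v, y} \<in> E}"
  have all: "w \<in> N" if w: "w \<in> V" "w \<noteq> u" "w \<noteq> v" for w
  proof (rule ccontr)
    assume "w \<notin> N"
    have "(u, w) \<in> {(c, d). {c, d} \<in> del_vertices_edges E (insert v N)}\<^sup>*"
      by (rule connected_minus_star[where x = v])
        (use uv assms w \<open>w \<notin> N\<close> in \<open>auto simp: N_def insert_commute\<close>)
    then obtain y where "{u, y} \<in> E" "y \<notin> N"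
      by (rule converse_rtranclE) (use w in \<open>auto simp: del_vertices_edges_def\<close>)
    with twins edge_ends show False by (auto simp: N_def)
  qed
  have indep: "{a, b} \<notin> E" if "a \<in> N" "b \<in> N" for a b
    using that no_triangle[of v a b] by (auto simp: N_def)
  have le2: "card N \<le> 2"
  proof (rule ccontr)
    assume "\<not> card N \<le> 2"
    then have "3 \<le> card N" by simp
    then obtain T where "T \<subseteq> N" "card T = 3" by (metis obtain_subset_with_card_n)
    then obtain a b c where abc: "a \<in> N" "b \<in> N" "c \<in> N" "a \<noteq> b" "b \<noteq> c" "a \<noteq> c"
      unfolding card_3_iff by auto
    have nuv: "u \<notin> N" "v \<notin> N"
      using assms(4) edge_ends[of v v] by (auto simp: N_def insert_commute)
    have a: "a \<in> V" "{a, u} \<in> E" "{a, v} \<in> E" and bc: "b \<in> V" "c \<in> V"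
      using abc twins[of a] by (auto simp: N_def insert_commute)
    have "(b, c) \<in> {(x, y). {x, y} \<in> del_vertices_edges E {a, u, v}}\<^sup>*"
      by (rule connected_minus_star[where x = a]) (use a bc abc nuv uv in auto)
    then obtain y where "{b, y} \<in> E" "y \<notin> {a, u, v}"
      by (rule converse_rtranclE) (use abc in \<open>auto simp: del_vertices_edges_def\<close>)
    with all edge_ends indep abc(2) show False by blast
  qed
  have finN: "finite N" using graph by (auto simp: N_def simple_graph_def)
  have "E \<subseteq> (\<lambda>w. {u, w}) ` N \<union> (\<lambda>w. {v, w}) ` N"
  proof
    fix e assume "e \<in> E"
    then obtain a b where ab: "e = {a, b}" "a \<in> V" "b \<in> V" "a \<noteq> b" by (rule edgeE)
    have "a \<in> {u, v} \<and> b \<in> N \<or> b \<in> {u, v} \<and> a \<in> N"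
    proof -
      have "a \<in> {u, v} \<or> a \<in> N" "b \<in> {u, v} \<or> b \<in> N"
        using all ab(2,3) by auto
      moreover have "\<not> (a \<in> N \<and> b \<in> N)"
        using indep \<open>e \<in> E\<close> ab(1) by blast
      moreover have "\<not> (a \<in> {u, v} \<and> b \<in> {u, v})"
        using \<open>e \<in> E\<close> ab(1,4) assms(4) by (auto simp: insert_commute)
      ultimately show ?thesis by blast
    qed
    then show "e \<in> (\<lambda>w. {u, w}) ` N \<union> (\<lambda>w. {v, w}) ` N"
      using ab(1) by (auto simp: insert_commute)
  qed
  then have "card E \<le> card ((\<lambda>w. {u, w}) ` N \<union> (\<lambda>w. {v, w}) ` N)"
    by (rule card_mono[rotated]) (simp add: finN)
  also have "\<dots> \<le> card ((\<lambda>w. {u, w}) ` N) + card ((\<lambda>w. {v, w}) ` N)"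
    by (rule card_Un_le)
  also have "\<dots> \<le> card N + card N"
    by (intro add_mono card_image_le finN)
  finally show ?thesis using le2 by simp
qed

lemma finite_union: "finite (\<Union>v\<in>V. f v)"
  using graph finite_sets by (auto simp: simple_graph_def)

lemma representation_size_ge_3:
  assumes "E \<noteq> {}"
  shows "3 \<le> representation_size V f"
proof -
  obtain u v where uv: "{u, v} \<in> E" using assms edgeE by (metis all_not_in_conv)
  then obtain x y z where "x \<in> f u \<inter> f v" "y \<in> f u - f v" "z \<in> f v - f u"
    using edge_overlap unfolding overlap_def by blast
  moreover from this have "card {x, y, z} = 3" by (auto simp: card_3_iff)
  ultimately show ?thesis
    using edge_ends[OF uv] card_mono[OF finite_union, of "{x, y, z}"]
    unfolding representation_size_def by auto
qed

section \<open>Private points of edges\<close>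

text \<open>When both ends are non-engulfing, a common point lies in no third non-engulfing set, since that
  would give a triangle. When \<open>b\<close> is engulfing, every vertex with a point outside \<open>f b\<close> is \<open>b\<close> itself
  or a neighbour of \<open>b\<close>; the neighbours of \<open>b\<close> are pairwise non-adjacent, so the non-engulfing ones
  among them have disjoint sets.\<close>

lemma private_point:
  assumes "e \<in> E" "\<not> e \<subseteq> Collect engulfing"
  shows "\<exists>x\<in>(\<Union>v\<in>V. f v). {w \<in> V. \<not> engulfing w \<and> x \<in> f w} = e - Collect engulfing"
proof -
  obtain a b where ab: "e = {a, b}" "\<not> engulfing a"
  proof -
    obtain u v where uv: "e = {u, v}" using assms(1) by (rule edgeE)
    show ?thesis
    proof (cases "engulfing u")
      case True
      then have "\<not> engulfing v" using assms(2) uv by simp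
      moreover have "e = {v, u}" using uv by (simp add: insert_commute)
      ultimately show ?thesis by (rule that[rotated])
    qed (rule that[OF uv])
  qed
  have E: "{a, b} \<in> E" and V: "a \<in> V" "b \<in> V" "a \<noteq> b"
    using assms(1) ab(1) edge_ends by auto
  show ?thesis
  proof (cases "engulfing b")
    case False
    obtain x where x: "x \<in> f a" "x \<in> f b"
      using edge_overlap[OF E] unfolding overlap_def by blast
    have "w = a \<or> w = b" if w: "w \<in> V" "\<not> engulfing w" "x \<in> f w" for w
    proof (rule ccontr)
      assume ne: "\<not> (w = a \<or> w = b)"
      have "{a, w} \<in> E" "{b, w} \<in> E"
        using non_engulfing_disjoint[of a w] non_engulfing_disjoint[of b w] w ne V x ab(2) False
        by auto
      then show False using no_triangle[OF E] by blast
    qed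
    then have "{w \<in> V. \<not> engulfing w \<and> x \<in> f w} = e - Collect engulfing"
      using x V ab False by blast
    then show ?thesis using x V by blast
  next
    case True
    obtain x where x: "x \<in> f a" "x \<notin> f b"
      using edge_overlap[OF E] unfolding overlap_def by blast
    have "w = a" if w: "w \<in> V" "\<not> engulfing w" "x \<in> f w" for w
    proof (rule ccontr)
      assume ne: "w \<noteq> a"
      have "{b, w} \<in> E"
        using engulfing_contains_all_nonneighbours[OF True w(1)] w(2,3) True x(2)
        by (metis insert_commute subsetD)
      moreover have "{a, w} \<in> E"
        using non_engulfing_disjoint[of a w] w ne V x ab(2) by auto
      ultimately show False using no_triangle[OF E] by blast
    qed
    then have "{w \<in> V. \<not> engulfing w \<and> x \<in> f w} = e - Collect engulfing"
      using x V ab True by blast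
    then show ?thesis using x V by blast
  qed
qed

lemma card_edges_le: "card E \<le> representation_size V f + 1"
proof (cases "\<exists>u v. engulfing u \<and> engulfing v \<and> u \<noteq> v \<and> {u, v} \<notin> E")
  case True
  then have "card E \<le> 4" using card_edges_le_4_of_nonadjacent_engulfing by blast
  then show ?thesis using representation_size_ge_3 by (cases "E = {}") auto
next
  case False
  then have clique: "{u, v} \<in> E" if "engulfing u" "engulfing v" "u \<noteq> v" for u v
    using that by blast
  define B where "B = {e \<in> E. e \<subseteq> Collect engulfing}"
  define core where "core e = e - Collect engulfing" for e
  define tr where "tr x = {w \<in> V. \<not> engulfing w \<and> x \<in> f w}" for x
  have finE: "finite E"
  proof (rule finite_subset)
    show "E \<subseteq> Pow V" using edgeE by blast
    show "finite (Pow V)" using graph by (simp add: simple_graph_def)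
  qed
  have "e = e'" if "e \<in> B" "e' \<in> B" for e e'
  proof -
    from that have "e \<in> E" "e' \<in> E" by (auto simp: B_def)
    then obtain a b c d where e: "e = {a, b}" "a \<noteq> b" "e' = {c, d}" "c \<noteq> d"
      using edgeE by metis
    have big: "engulfing a" "engulfing b" "engulfing c" "engulfing d"
      using that e by (auto simp: B_def)
    have "w = a \<or> w = b" if "engulfing w" for w
      using that clique[of a w] clique[of b w] clique[of a b] no_triangle[of a b w] big e(2) by auto
    with big e show ?thesis by (metis insert_commute)
  qed
  then have cardB: "card B \<le> 1"
    by (intro iffD2[OF card_le_Suc0_iff_eq, folded One_nat_def])
      (use finE in \<open>auto simp: B_def\<close>)
  \<comment> \<open>If two edges share their only non-engulfing end, then their engulfing ends are distinct and
    hence adjacent, which closes a triangle.\<close>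
  have inj: "inj_on core (E - B)"
  proof (rule inj_onI)
    fix e e' assume e: "e \<in> E - B" and e': "e' \<in> E - B" and eq: "core e = core e'"
    obtain a where a: "a \<in> core e" using e by (auto simp: B_def core_def)
    then have "a \<in> e" "a \<in> e'" and na: "\<not> engulfing a" using eq by (auto simp: core_def)
    have other_end: "\<exists>b. d = {a, b} \<and> a \<noteq> b" if "d \<in> E" "a \<in> d" for d
      using that(1) by (rule edgeE) (use that(2) in \<open>auto simp: insert_commute\<close>)
    obtain b b' where b: "e = {a, b}" "e' = {a, b'}" "a \<noteq> b" "a \<noteq> b'"
      using other_end[of e] other_end[of e'] e e' \<open>a \<in> e\<close> \<open>a \<in> e'\<close> by blast
    have "engulfing b \<and> engulfing b'" if "b \<noteq> b'"
      using that eq b by (auto simp: core_def)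
    then have "{b, b'} \<in> E" if "b \<noteq> b'"
      using that clique by blast
    then have "b = b'" using no_triangle[of a b b'] e e' b by auto
    with b show "e = e'" by simp
  qed
  have "core ` (E - B) \<subseteq> tr ` (\<Union>v\<in>V. f v)"
  proof (rule image_subsetI)
    fix e assume "e \<in> E - B"
    then have "\<exists>x\<in>(\<Union>v\<in>V. f v). tr x = core e"
      unfolding tr_def core_def by (intro private_point) (auto simp: B_def)
    then show "core e \<in> tr ` (\<Union>v\<in>V. f v)" by (metis imageI)
  qed
  then have "card (core ` (E - B)) \<le> card (\<Union>v\<in>V. f v)"
    by (rule surj_card_le[OF finite_union])
  then have "card (E - B) \<le> representation_size V f"
    unfolding representation_size_def by (simp only: card_image[OF inj])
  moreover have "card E - card B \<le> card (E - B)"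
    by (rule diff_card_le_card_Diff) (use finE in \<open>auto simp: B_def\<close>)
  ultimately show ?thesis using cardB by linarith
qed

end

section \<open>The overlap number\<close>

theorem theorem3p10:
  fixes V :: "'a set" and E :: "'a set set"
  assumes "simple_graph V E"
    and "triangle_free E"
    and "\<not> (\<exists>S. star_cutset V E S)"
  shows "int (overlap_number V E) \<ge> int (card E) - 1"
proof -
  have "\<exists>n. \<exists>f :: 'a \<Rightarrow> nat set.
      overlap_representation V E f \<and> (\<forall>v\<in>V. finite (f v)) \<and> representation_size V f = n"
    using ex_overlap_representation[OF assms(1)] by blast
  then have "\<exists>f :: 'a \<Rightarrow> nat set. overlap_representation V E f \<and> (\<forall>v\<in>V. finite (f v)) \<and>
      representation_size V f = overlap_number V E"
    unfolding overlap_number_def by (rule LeastI_ex)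
  then obtain f :: "'a \<Rightarrow> nat set" where f: "overlap_representation V E f"
    "\<And>v. v \<in> V \<Longrightarrow> finite (f v)" "representation_size V f = overlap_number V E"
    by blast
  interpret starless_overlap_representation V E f
    by unfold_locales (use assms f in auto)
  show ?thesis using card_edges_le f(3) by linarith
qed

end
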